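(* Let $(X,\rho)$ be a complete metric space. Let $\{S_i\}_{i\in\mathbb{N}}$ ($\mathbb{N}=\{1,2,\ldots\}$) be a countable system of contractions, i.e. maps $S_i:X\to X$ with Lipschitz constant strictly less than $1$ for each $i\in\mathbb{N}$, with fixed points $x_i$ (so $S_i(x_i)=x_i$). Let $(p_1,p_2,\ldots)$ be a probability vector, i.e. $p_i\ge 0$ for $i\in\mathbb{N}$ and $\sum_{i\in\mathbb{N}}p_i=1$, satisfying $\sum_{i\in\mathbb{N}}p_i\,\rho(x_1,x_i)<\infty$. Then there is a unique measure $\nu\in M(X)$ such that $$\nu(A)=\sum_{i=1}^{\infty}p_i\,\nu\bigl(S_i^{-1}(A)\bigr)\quad\text{for all Borel sets } A\subseteq X.$$
   Context: A measure on $X$ is a nonnegative countably additive set function on the Borel $\sigma$-algebra $\mathcal{B}(X)$ vanishing on $\varnothing$. A subset of $X$ is separable if it is contained in the closure of an at most countable subset. A measure $\mu$ on $X$ is separable if there is a separable Borel set $A\subset X$ with $\mu(X\setminus A)=0$. $M(X)$ is the set of all separable measures $\mu$ on $X$ with $\mu(X)=1$ and $\int_X f\,d\mu<+\infty$ for every Lipschitz function $f:X\to\mathbb{R}$ (so every Lipschitz function is $\mu$-integrable). *)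

theory Defs
  imports "HOL-Probability.Probability"
begin

definition separable_set :: "'a::topological_space set \<Rightarrow> bool" where
  "separable_set A \<longleftrightarrow> (\<exists>C. countable C \<and> A \<subseteq> closure C)"

definition separable_measure :: "'a::topological_space measure \<Rightarrow> bool" where
  "separable_measure \<mu> \<longleftrightarrow>
     (\<exists>A\<in>sets borel. separable_set A \<and> emeasure \<mu> (UNIV - A) = 0)"

(* The set M(X) for X = UNIV :: 'a set. *)
definition M_space :: "'a::metric_space measure set" where
  "M_space = {\<mu>. sets \<mu> = sets borel \<and> separable_measure \<mu> \<and> prob_space \<mu> \<and>
     (\<forall>f :: 'a \<Rightarrow> real. (\<exists>L. L-lipschitz_on UNIV f) \<longrightarrow> integrable \<mu> f)}"

end

theory Submission
  imports Defs
begin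

text \<open>
  Regard the system as one random map: draw an index \<open>i\<close> with probability \<open>p\<^sub>i\<close> and apply
  \<open>S\<^sub>i\<close>. Although the Lipschitz constants \<open>L\<^sub>i\<close> may come arbitrarily close to \<open>1\<close>, their
  mean \<open>r = \<Sum>i. p\<^sub>i L\<^sub>i\<close> is strictly smaller than \<open>1\<close>, and this mean is what drives the
  whole argument. The moment condition on the fixed points enters as the statement that
  the mean displacement \<open>\<Sum>i. p\<^sub>i \<rho>(a, S\<^sub>i a)\<close> of the base point \<open>a = x\<^sub>1\<close> is finite: the
  displacement of \<open>a\<close> under \<open>S\<^sub>i\<close> is at most \<open>2 \<rho>(x\<^sub>1, x\<^sub>i)\<close>.

  \<^bold>\<open>Existence.\<close> Let \<open>R\<^sub>1, R\<^sub>2, \<dots>\<close> be independent copies of the random map, composed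
  backwards: \<open>Y\<^sub>n = R\<^sub>1 (R\<^sub>2 (\<dots> (R\<^sub>n a)))\<close>. Consecutive terms are at mean distance at most
  \<open>r\<^sup>n\<close> times the mean displacement (\<open>nn_integral_orbit_step\<close>), so almost surely the steps
  are summable and \<open>Y\<^sub>n\<close> converges, by completeness, to some \<open>Y\<close>. By continuity
  \<open>Y = R\<^sub>1 Y'\<close>, where \<open>Y'\<close> is the limit built from \<open>R\<^sub>2, R\<^sub>3, \<dots>\<close> (\<open>AE_orbit_limit_Stream\<close>).
  As \<open>Y'\<close> is independent of \<open>R\<^sub>1\<close> and has the law of \<open>Y\<close>, this law is stationary. It is
  separable because every \<open>Y\<^sub>n\<close> takes values in the countable set of images of \<open>a\<close> under
  finite compositions, and \<open>\<rho>(a, Y)\<close> has finite mean because the mean steps form a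
  convergent geometric series.

  \<^bold>\<open>Uniqueness.\<close> Stationarity turns \<open>\<integral>f d\<nu>\<close> into \<open>\<Sum>i. p\<^sub>i \<integral>f \<circ> S\<^sub>i d\<nu>\<close>, where \<open>f \<circ> S\<^sub>i\<close> has
  Lipschitz constant \<open>C L\<^sub>i\<close> if \<open>f\<close> has constant \<open>C\<close>. Hence each use of stationarity
  gains a factor \<open>r\<close> in a bound for the difference of the integrals of \<open>f\<close> against two
  stationary measures (\<open>stationary_integrals_geometrically_close\<close>). The integrals agree in
  the limit, and integrals of Lipschitz functions determine a finite Borel measure
  (\<open>measure_eqI_lipschitz\<close>).
\<close>

section \<open>Lipschitz functions, finite Borel measures and Cauchy sequences\<close>

lemma lipschitz_borel_measurable:
  fixes f :: "'a::metric_space \<Rightarrow> 'b::metric_space"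
  assumes "C-lipschitz_on UNIV f"
  shows "f \<in> borel_measurable borel"
  using assms by (intro borel_measurable_continuous_onI lipschitz_on_continuous_on)

lemma lipschitz_dist: "1-lipschitz_on UNIV (\<lambda>y::'a::metric_space. dist a y)"
proof (rule lipschitz_onI)
  show "dist (dist a y) (dist a z) \<le> 1 * dist y z" for y z
    using abs_dist_diff_le[of y a z] by (simp add: dist_real_def dist_commute)
qed simp

lemma lipschitz_ramp:
  fixes F :: "'a::metric_space set"
  shows "(real n)-lipschitz_on UNIV (\<lambda>y. max 0 (1 - real n * infdist y F))"
proof (rule lipschitz_onI)
  fix y z :: 'a
  have "\<bar>infdist y F - infdist z F\<bar> \<le> dist y z"
    using infdist_triangle_abs by blast
  then have "real n * \<bar>infdist y F - infdist z F\<bar> \<le> real n * dist y z"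
    by (rule mult_left_mono) simp
  then have "\<bar>real n * infdist y F - real n * infdist z F\<bar> \<le> real n * dist y z"
    by (simp add: abs_mult flip: right_diff_distrib)
  then show "dist (max 0 (1 - real n * infdist y F)) (max 0 (1 - real n * infdist z F)) \<le> real n * dist y z"
    unfolding dist_real_def by linarith
qed simp

text \<open>
  A closed set contains every point at distance \<open>0\<close> from it, so off the set the ramps
  eventually vanish. Non-emptiness matters because \<open>infdist y {} = 0\<close>, which makes the ramps
  of the empty set constantly \<open>1\<close>.
\<close>
lemma ramp_tendsto_indicator:
  fixes F :: "'a::metric_space set"
  assumes "closed F" "F \<noteq> {}"
  shows "(\<lambda>n. max 0 (1 - real n * infdist y F)) \<longlonglongrightarrow> indicator F y"
proof (cases "y \<in> F")
  case True
  then show ?thesis by simp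
next
  case False
  then have pos: "infdist y F > 0"
    using assms infdist_pos_not_in_closed by blast
  obtain N :: nat where N: "1 < real N * infdist y F"
    using reals_Archimedean3[OF pos] by blast
  have "\<forall>\<^sub>F n in sequentially. max 0 (1 - real n * infdist y F) = 0"
  proof (rule eventually_sequentiallyI[of N])
    fix n assume "N \<le> n"
    then have "real N * infdist y F \<le> real n * infdist y F"
      using pos by (intro mult_right_mono) auto
    then show "max 0 (1 - real n * infdist y F) = 0" using N by simp
  qed
  then show ?thesis using False by (simp add: tendsto_eventually)
qed

text \<open>
  Closed sets form an intersection-stable generator of the Borel sets, and dominated
  convergence along the Lipschitz ramps recovers the measure of a closed set.
\<close>
lemma measure_eqI_lipschitz:
  fixes \<mu> \<nu> :: "'a::metric_space measure"
  assumes fin: "finite_measure \<mu>" "finite_measure \<nu>"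
    and sets: "sets \<mu> = sets borel" "sets \<nu> = sets borel"
    and eq: "\<And>(f :: 'a \<Rightarrow> real) C. C-lipschitz_on UNIV f \<Longrightarrow> (\<integral>y. f y \<partial>\<mu>) = (\<integral>y. f y \<partial>\<nu>)"
  shows "\<mu> = \<nu>"
proof -
  interpret \<mu>: finite_measure \<mu> by fact
  interpret \<nu>: finite_measure \<nu> by fact
  have lim: "(\<lambda>n. \<integral>y. max 0 (1 - real n * infdist y F) \<partial>M) \<longlonglongrightarrow> measure M F"
    if F: "closed F" "F \<noteq> {}" and M: "finite_measure M" "sets M = sets borel"
    for F :: "'a set" and M
  proof -
    interpret finite_measure M by fact
    have sp: "space M = UNIV" using sets_eq_imp_space_eq[OF M(2)] by simp
    have "(\<lambda>n. \<integral>y. max 0 (1 - real n * infdist y F) \<partial>M) \<longlonglongrightarrow> (\<integral>y. indicator F y \<partial>M)"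
    proof (rule integral_dominated_convergence[where w="\<lambda>_. 1"])
      show "indicat_real F \<in> borel_measurable M"
        using F(1) M(2) by (intro borel_measurable_indicator) simp
      show "(\<lambda>y. max 0 (1 - real n * infdist y F)) \<in> borel_measurable M" for n
        using lipschitz_borel_measurable[OF lipschitz_ramp] M(2)
        by (metis measurable_cong_sets)
      show "AE y in M. (\<lambda>n. max 0 (1 - real n * infdist y F)) \<longlonglongrightarrow> indicat_real F y"
        using ramp_tendsto_indicator[OF F] by simp
      show "AE y in M. norm (max 0 (1 - real n * infdist y F)) \<le> 1" for n
        by (simp add: infdist_nonneg)
    qed simp
    then show ?thesis by (simp add: sp)
  qed
  show ?thesis
  proof (rule measure_eqI_generator_eq[of "Collect closed" UNIV _ _ "\<lambda>_. UNIV"])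
    show "Int_stable (Collect closed :: 'a set set)" by (auto simp: Int_stable_def)
    show "sets \<mu> = sigma_sets UNIV (Collect closed)" "sets \<nu> = sigma_sets UNIV (Collect closed)"
      using sets by (simp_all add: borel_eq_closed)
    fix F :: "'a set" assume "F \<in> Collect closed"
    then have F: "closed F" by simp
    have "measure \<mu> F = measure \<nu> F"
    proof (cases "F = {}")
      case False
      have "(\<lambda>n. \<integral>y. max 0 (1 - real n * infdist y F) \<partial>\<mu>) \<longlonglongrightarrow> measure \<nu> F"
        using lim[OF F False fin(2) sets(2)] by (simp add: eq[OF lipschitz_ramp])
      with lim[OF F False fin(1) sets(1)] show ?thesis
        by (rule LIMSEQ_unique)
    qed simp
    then show "emeasure \<mu> F = emeasure \<nu> F"
      by (simp add: \<mu>.emeasure_eq_measure \<nu>.emeasure_eq_measure)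
  qed auto
qed

lemma Cauchy_if_summable_steps:
  fixes u :: "nat \<Rightarrow> 'a::metric_space"
  assumes "summable (\<lambda>n. dist (u n) (u (Suc n)))"
  shows "Cauchy u"
proof (rule metric_CauchyI)
  fix e :: real assume "0 < e"
  then obtain N where N: "\<And>m n. N \<le> m \<Longrightarrow> norm (\<Sum>k=m..<n. dist (u k) (u (Suc k))) < e"
    using assms unfolding summable_Cauchy by meson
  have steps: "dist (u m) (u (m + j)) \<le> (\<Sum>k=m..<m+j. dist (u k) (u (Suc k)))" for m j
  proof (induction j)
    case (Suc j)
    then show ?case
      using dist_triangle[of "u m" "u (Suc (m + j))" "u (m + j)"] by simp
  qed simp
  have close: "dist (u m) (u n) < e" if "N \<le> m" "m \<le> n" for m n
    using steps[of m "n - m"] N[OF that(1), of n] that(2) by simp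
  show "\<exists>N. \<forall>m\<ge>N. \<forall>n\<ge>N. dist (u m) (u n) < e"
  proof (intro exI allI impI)
    fix m n assume "N \<le> m" "N \<le> n"
    then show "dist (u m) (u n) < e"
      using close[of m n] close[of n m] by (cases "m \<le> n") (auto simp: dist_commute)
  qed
qed

section \<open>Stationary measures of a random map\<close>

text \<open>
  Contraction is assumed in the mean only, because both halves of the argument average over
  the first index before they use a contraction factor.
\<close>
locale average_contraction =
  fixes P :: "'i::countable pmf" and T :: "'i \<Rightarrow> 'a::complete_space \<Rightarrow> 'a"
    and L :: "'i \<Rightarrow> real" and a :: 'a
  assumes lipschitz: "\<And>i. (L i)-lipschitz_on UNIV (T i)"
    and integrable_L: "integrable (measure_pmf P) L"
    and mean_L: "(\<integral>i. L i \<partial>measure_pmf P) < 1"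
    and integrable_displacement: "integrable (measure_pmf P) (\<lambda>i. dist a (T i a))"
begin

definition stationary :: "'a measure \<Rightarrow> bool" where
  "stationary \<nu> \<longleftrightarrow>
     (\<forall>A\<in>sets borel. emeasure \<nu> A = (\<integral>\<^sup>+i. emeasure \<nu> (T i -` A) \<partial>measure_pmf P))"

definition rate :: real where "rate = (\<integral>i. L i \<partial>measure_pmf P)"

lemma L_nonneg: "0 \<le> L i"
  using lipschitz lipschitz_on_nonneg by blast

lemma dist_T: "dist (T i y) (T i z) \<le> L i * dist y z"
  using lipschitz lipschitz_onD by blast

lemma rate_nonneg: "0 \<le> rate"
  unfolding rate_def by (simp add: L_nonneg)

lemma rate_less_1: "rate < 1"
  using mean_L by (simp add: rate_def)

lemma measurable_T [measurable]: "T i \<in> borel_measurable borel"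
  using lipschitz by (rule lipschitz_borel_measurable)

subsection \<open>Uniqueness\<close>

text \<open>
  The right-hand side of the stationarity equation is the law of \<open>T i y\<close> for independent
  \<open>i\<close> and \<open>y\<close>. This form lets the equation pass from sets to integrals by Fubini's theorem.
  Joint measurability holds because the index set is countable and discrete.
\<close>
lemma stationary_eq_distr:
  assumes \<nu>: "prob_space \<nu>" "sets \<nu> = sets borel" and "stationary \<nu>"
  shows "(\<lambda>(i, y). T i y) \<in> borel_measurable (measure_pmf P \<Otimes>\<^sub>M \<nu>)"
    and "\<nu> = distr (measure_pmf P \<Otimes>\<^sub>M \<nu>) borel (\<lambda>(i, y). T i y)"
proof -
  interpret prob_space \<nu> by fact
  note \<nu>(2)[measurable_cong]
  have "(\<lambda>(i, y). T i y) \<in> borel_measurable (count_space UNIV \<Otimes>\<^sub>M \<nu>)"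
    by (rule measurable_pair_measure_countable1) auto
  also have "borel_measurable (count_space UNIV \<Otimes>\<^sub>M \<nu>) =
      borel_measurable (measure_pmf P \<Otimes>\<^sub>M \<nu>)"
    by (intro measurable_cong_sets sets_pair_measure_cong) auto
  finally show meas [measurable]:
    "(\<lambda>(i, y). T i y) \<in> borel_measurable (measure_pmf P \<Otimes>\<^sub>M \<nu>)" .
  have sp: "space (measure_pmf P \<Otimes>\<^sub>M \<nu>) = UNIV"
    using sets_eq_imp_space_eq[OF \<nu>(2)] by (simp add: space_pair_measure)
  show "\<nu> = distr (measure_pmf P \<Otimes>\<^sub>M \<nu>) borel (\<lambda>(i, y). T i y)"
  proof (rule measure_eqI)
    fix A assume "A \<in> sets \<nu>"
    then have A: "A \<in> sets borel" using \<nu> by simp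
    have "emeasure (distr (measure_pmf P \<Otimes>\<^sub>M \<nu>) borel (\<lambda>(i, y). T i y)) A =
        emeasure (measure_pmf P \<Otimes>\<^sub>M \<nu>) ((\<lambda>(i, y). T i y) -` A)"
      using A by (simp add: emeasure_distr sp)
    also have "\<dots> = (\<integral>\<^sup>+i. emeasure \<nu> (Pair i -` (\<lambda>(i, y). T i y) -` A) \<partial>measure_pmf P)"
      using measurable_sets[OF meas A] by (intro emeasure_pair_measure_alt) (simp add: sp)
    also have "\<dots> = (\<integral>\<^sup>+i. emeasure \<nu> (T i -` A) \<partial>measure_pmf P)"
      by (intro nn_integral_cong arg_cong[where f="emeasure \<nu>"]) auto
    finally show "emeasure \<nu> A = emeasure (distr (measure_pmf P \<Otimes>\<^sub>M \<nu>) borel (\<lambda>(i, y). T i y)) A"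
      using \<open>stationary \<nu>\<close> A by (simp add: stationary_def)
  qed (use \<nu> in simp)
qed

lemma stationary_integral:
  fixes f :: "'a \<Rightarrow> real"
  assumes \<nu>: "prob_space \<nu>" "sets \<nu> = sets borel" "stationary \<nu>" and f: "integrable \<nu> f"
  shows "integrable (measure_pmf P) (\<lambda>i. \<integral>y. f (T i y) \<partial>\<nu>)"
    and "(\<integral>y. f y \<partial>\<nu>) = (\<integral>i. (\<integral>y. f (T i y) \<partial>\<nu>) \<partial>measure_pmf P)"
proof -
  interpret prob_space \<nu> by fact
  interpret pair_sigma_finite "measure_pmf P" \<nu> ..
  note meas = stationary_eq_distr(1)[OF \<nu>] and distr = stationary_eq_distr(2)[OF \<nu>]
  have fm: "f \<in> borel_measurable borel"
    using borel_measurable_integrable[OF f] \<nu>(2) by (metis measurable_cong_sets)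
  have "integrable (distr (measure_pmf P \<Otimes>\<^sub>M \<nu>) borel (\<lambda>(i, y). T i y)) f"
    using f distr by simp
  then have int: "integrable (measure_pmf P \<Otimes>\<^sub>M \<nu>) (\<lambda>(i, y). f (T i y))"
    using integrable_distr_eq[OF meas fm] by (simp add: case_prod_unfold)
  show "integrable (measure_pmf P) (\<lambda>i. \<integral>y. f (T i y) \<partial>\<nu>)"
    using integrable_fst'[OF int] by simp
  have "(\<integral>y. f y \<partial>\<nu>) = (\<integral>z. f (case z of (i, y) \<Rightarrow> T i y) \<partial>(measure_pmf P \<Otimes>\<^sub>M \<nu>))"
    by (subst distr) (rule integral_distr[OF meas fm])
  also have "\<dots> = (\<integral>z. (case z of (i, y) \<Rightarrow> f (T i y)) \<partial>(measure_pmf P \<Otimes>\<^sub>M \<nu>))"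
    by (intro Bochner_Integration.integral_cong) auto
  also have "\<dots> = (\<integral>i. (\<integral>y. f (T i y) \<partial>\<nu>) \<partial>measure_pmf P)"
    using integral_fst'[OF int] by simp
  finally show "(\<integral>y. f y \<partial>\<nu>) = (\<integral>i. (\<integral>y. f (T i y) \<partial>\<nu>) \<partial>measure_pmf P)" .
qed

text \<open>
  This starts the induction below: both integrals of \<open>f\<close> are compared with the
  same number \<open>f a\<close>.
\<close>
lemma integral_lipschitz_near_base_point:
  fixes f :: "'a \<Rightarrow> real"
  assumes \<nu>: "\<nu> \<in> M_space" and f: "C-lipschitz_on UNIV f"
  shows "\<bar>(\<integral>y. f y \<partial>\<nu>) - f a\<bar> \<le> C * (\<integral>y. dist a y \<partial>\<nu>)"
proof -
  interpret prob_space \<nu> using \<nu> by (simp add: M_space_def)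
  have int: "integrable \<nu> f" and intd: "integrable \<nu> (\<lambda>y. dist a y)"
    using \<nu> f lipschitz_dist[of a] by (auto simp: M_space_def)
  have "(\<integral>y. f y \<partial>\<nu>) - f a = (\<integral>y. f y - f a \<partial>\<nu>)"
    using int by (simp add: prob_space)
  also have "\<bar>\<dots>\<bar> \<le> (\<integral>y. \<bar>f y - f a\<bar> \<partial>\<nu>)"
    by (rule integral_abs_bound)
  also have "\<dots> \<le> (\<integral>y. C * dist a y \<partial>\<nu>)"
  proof (rule integral_mono)
    fix y show "\<bar>f y - f a\<bar> \<le> C * dist a y"
      using lipschitz_onD[OF f, of y a] by (simp add: dist_real_def dist_commute)
  qed (use int intd in auto)
  finally show ?thesis by simp
qed

text \<open>
  Both integrals are averages over \<open>i\<close> of the integrals of \<open>f \<circ> T i\<close>. Applying the bound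
  for \<open>n\<close> to these functions, with constants \<open>C * L i\<close>, and averaging produces one more
  factor \<open>rate\<close>. The induction therefore has to range over all Lipschitz functions.
\<close>
lemma stationary_integrals_geometrically_close:
  fixes f :: "'a \<Rightarrow> real"
  assumes \<mu>: "\<mu> \<in> M_space" "stationary \<mu>" and \<nu>: "\<nu> \<in> M_space" "stationary \<nu>"
    and f: "C-lipschitz_on UNIV f"
  shows "\<bar>(\<integral>y. f y \<partial>\<mu>) - (\<integral>y. f y \<partial>\<nu>)\<bar>
    \<le> C * (rate ^ n * ((\<integral>y. dist a y \<partial>\<mu>) + (\<integral>y. dist a y \<partial>\<nu>)))"
  using f
proof (induction n arbitrary: f C)
  case 0
  show ?case
    using integral_lipschitz_near_base_point[OF \<mu>(1) 0] integral_lipschitz_near_base_point[OF \<nu>(1) 0]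
    by (simp add: distrib_left)
next
  case (Suc n)
  define K where "K = rate ^ n * ((\<integral>y. dist a y \<partial>\<mu>) + (\<integral>y. dist a y \<partial>\<nu>))"
  have M: "prob_space \<mu>" "sets \<mu> = sets borel" "integrable \<mu> f"
    and N: "prob_space \<nu>" "sets \<nu> = sets borel" "integrable \<nu> f"
    using \<mu>(1) \<nu>(1) Suc.prems by (auto simp: M_space_def)
  note sM = stationary_integral[OF M(1,2) \<mu>(2) M(3)] and sN = stationary_integral[OF N(1,2) \<nu>(2) N(3)]
  have "(\<integral>y. f y \<partial>\<mu>) - (\<integral>y. f y \<partial>\<nu>)
      = (\<integral>i. (\<integral>y. f (T i y) \<partial>\<mu>) - (\<integral>y. f (T i y) \<partial>\<nu>) \<partial>measure_pmf P)"
    using sM sN by simp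
  also have "\<bar>\<dots>\<bar> \<le> (\<integral>i. \<bar>(\<integral>y. f (T i y) \<partial>\<mu>) - (\<integral>y. f (T i y) \<partial>\<nu>)\<bar> \<partial>measure_pmf P)"
    by (rule integral_abs_bound)
  also have "\<dots> \<le> (\<integral>i. (C * L i) * K \<partial>measure_pmf P)"
  proof (rule integral_mono)
    fix i
    have "(C * L i)-lipschitz_on UNIV (\<lambda>y. f (T i y))"
      using lipschitz Suc.prems by (intro lipschitz_on_compose2) (auto intro: lipschitz_on_subset)
    from Suc.IH[OF this] show "\<bar>(\<integral>y. f (T i y) \<partial>\<mu>) - (\<integral>y. f (T i y) \<partial>\<nu>)\<bar> \<le> (C * L i) * K"
      by (simp add: K_def)
  qed (use sM(1) sN(1) integrable_L in auto)
  also have "\<dots> = C * (rate * K)" by (simp add: rate_def)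
  finally show ?case by (simp add: K_def mult.assoc)
qed

lemma stationary_unique:
  assumes \<mu>: "\<mu> \<in> M_space" "stationary \<mu>" and \<nu>: "\<nu> \<in> M_space" "stationary \<nu>"
  shows "\<mu> = \<nu>"
proof (rule measure_eqI_lipschitz)
  show "finite_measure \<mu>" "finite_measure \<nu>" "sets \<mu> = sets borel" "sets \<nu> = sets borel"
    using \<mu>(1) \<nu>(1) by (auto simp: M_space_def prob_space.finite_measure)
  fix f :: "'a \<Rightarrow> real" and C assume f: "C-lipschitz_on UNIV f"
  define K where "K = (\<integral>y. dist a y \<partial>\<mu>) + (\<integral>y. dist a y \<partial>\<nu>)"
  have "(\<lambda>n. C * (rate ^ n * K)) \<longlonglongrightarrow> C * (0 * K)"
    using rate_nonneg rate_less_1 by (intro tendsto_intros LIMSEQ_power_zero) simp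
  then have "\<bar>(\<integral>y. f y \<partial>\<mu>) - (\<integral>y. f y \<partial>\<nu>)\<bar> \<le> C * (0 * K)"
    using stationary_integrals_geometrically_close[OF \<mu> \<nu> f]
    by (intro LIMSEQ_le_const) (auto simp: K_def)
  then show "(\<integral>y. f y \<partial>\<mu>) = (\<integral>y. f y \<partial>\<nu>)" by simp
qed

subsection \<open>Existence\<close>

abbreviation \<Omega> :: "'i stream measure" where "\<Omega> \<equiv> stream_space (measure_pmf P)"

text \<open>
  The earliest index is applied last. With this backward order the points converge along
  almost every sequence, whereas the forward order yields a Markov chain that in general
  converges only in law.
\<close>
definition orbit :: "nat \<Rightarrow> 'i stream \<Rightarrow> 'a" where
  "orbit n \<omega> = foldr T (stake n \<omega>) a"

definition orbit_length :: "'i stream \<Rightarrow> ennreal" where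
  "orbit_length \<omega> = (\<Sum>n. ennreal (dist (orbit n \<omega>) (orbit (Suc n) \<omega>)))"

text \<open>
  The value \<open>a\<close> on the exceptional set keeps the limit in the closure of the countable
  orbit of \<open>a\<close> everywhere, not only almost surely.
\<close>
definition orbit_limit :: "'i stream \<Rightarrow> 'a" where
  "orbit_limit \<omega> = (if orbit_length \<omega> < \<infinity> then lim (\<lambda>n. orbit n \<omega>) else a)"

lemma space_\<Omega> [simp]: "space \<Omega> = UNIV"
  by (simp add: space_stream_space)

lemma prob_space_\<Omega>: "prob_space \<Omega>"
  by (rule prob_space.prob_space_stream_space[OF prob_space_measure_pmf])

lemma orbit_0 [simp]: "orbit 0 \<omega> = a"
  by (simp add: orbit_def)

lemma orbit_Suc_Stream: "orbit (Suc n) (i ## \<omega>) = T i (orbit n \<omega>)"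
  by (simp add: orbit_def)

text \<open>
  There are only countably many words of length \<open>n\<close>, so every function of the first \<open>n\<close>
  indices is measurable. For distances between two orbit points this is essential: in a
  space that is not second countable, the distance of two Borel functions can fail to be
  measurable.
\<close>
lemma measurable_stake_\<Omega>:
  assumes "\<And>l. g l \<in> space N"
  shows "(\<lambda>\<omega>. g (stake n \<omega>)) \<in> measurable \<Omega> N"
proof -
  have "(\<lambda>\<omega>. g (stake n \<omega>)) \<in> measurable (stream_space (count_space UNIV)) N"
    by (rule measurable_compose[OF measurable_stake]) (use assms in auto)
  then show ?thesis
    by (subst measurable_cong_sets[OF sets_stream_space_cong refl]) simp_all
qed

lemma measurable_orbit [measurable]: "orbit n \<in> borel_measurable \<Omega>"
  unfolding orbit_def[abs_def] by (rule measurable_stake_\<Omega>) simp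

lemma measurable_orbit_step [measurable]:
  "(\<lambda>\<omega>. dist (orbit n \<omega>) (orbit (Suc n) \<omega>)) \<in> borel_measurable \<Omega>"
proof -
  have "(\<lambda>\<omega>. dist (orbit n \<omega>) (orbit (Suc n) \<omega>)) =
      (\<lambda>\<omega>. (\<lambda>l. dist (foldr T (take n l) a) (foldr T l a)) (stake (Suc n) \<omega>))"
    by (simp add: orbit_def take_stake del: stake.simps)
  then show ?thesis using measurable_stake_\<Omega>[of _ borel] by simp
qed

lemma measurable_orbit_length [measurable]: "orbit_length \<in> borel_measurable \<Omega>"
  unfolding orbit_length_def[abs_def] by measurable

text \<open>
  Splitting off the first index, which is independent of the others, compares step \<open>n + 1\<close>
  with step \<open>n\<close> at the cost of a factor \<open>L i\<close>, whose mean is \<open>rate\<close>.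
\<close>
lemma nn_integral_orbit_step:
  "(\<integral>\<^sup>+\<omega>. ennreal (dist (orbit n \<omega>) (orbit (Suc n) \<omega>)) \<partial>\<Omega>)
    \<le> ennreal (rate ^ n * (\<integral>i. dist a (T i a) \<partial>measure_pmf P))"
proof (induction n)
  interpret \<Omega>: prob_space \<Omega> by (rule prob_space_\<Omega>)
  case 0
  have "(\<integral>\<^sup>+\<omega>. ennreal (dist (orbit 0 \<omega>) (orbit (Suc 0) \<omega>)) \<partial>\<Omega>) =
      (\<integral>\<^sup>+i. (\<integral>\<^sup>+\<omega>. ennreal (dist a (T i a)) \<partial>\<Omega>) \<partial>measure_pmf P)"
    by (subst prob_space.nn_integral_stream_space[OF prob_space_measure_pmf])
      (use measurable_orbit_step[of 0] in \<open>simp_all add: orbit_Suc_Stream\<close>)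
  also have "\<dots> = (\<integral>\<^sup>+i. ennreal (dist a (T i a)) \<partial>measure_pmf P)"
    by (simp add: \<Omega>.emeasure_space_1[simplified])
  also have "\<dots> = ennreal (\<integral>i. dist a (T i a) \<partial>measure_pmf P)"
    using integrable_displacement by (intro nn_integral_eq_integral) auto
  finally show ?case by simp
next
  case (Suc n)
  define D where "D = (\<integral>i. dist a (T i a) \<partial>measure_pmf P)"
  have "(\<integral>\<^sup>+\<omega>. ennreal (dist (orbit (Suc n) \<omega>) (orbit (Suc (Suc n)) \<omega>)) \<partial>\<Omega>) =
      (\<integral>\<^sup>+i. (\<integral>\<^sup>+\<omega>. ennreal (dist (T i (orbit n \<omega>)) (T i (orbit (Suc n) \<omega>))) \<partial>\<Omega>) \<partial>measure_pmf P)"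
    by (subst prob_space.nn_integral_stream_space[OF prob_space_measure_pmf]) (simp_all add: orbit_Suc_Stream)
  also have "\<dots> \<le> (\<integral>\<^sup>+i. (\<integral>\<^sup>+\<omega>. ennreal (L i) * ennreal (dist (orbit n \<omega>) (orbit (Suc n) \<omega>)) \<partial>\<Omega>) \<partial>measure_pmf P)"
    by (intro nn_integral_mono) (simp add: dist_T L_nonneg ennreal_leI flip: ennreal_mult)
  also have "\<dots> = (\<integral>\<^sup>+i. ennreal (L i) * (\<integral>\<^sup>+\<omega>. ennreal (dist (orbit n \<omega>) (orbit (Suc n) \<omega>)) \<partial>\<Omega>) \<partial>measure_pmf P)"
    by (intro nn_integral_cong nn_integral_cmult) measurable
  also have "\<dots> \<le> (\<integral>\<^sup>+i. ennreal (L i) * ennreal (rate ^ n * D) \<partial>measure_pmf P)"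
    unfolding D_def by (intro nn_integral_mono mult_left_mono Suc.IH) simp
  also have "\<dots> = (\<integral>\<^sup>+i. ennreal (L i) \<partial>measure_pmf P) * ennreal (rate ^ n * D)"
    by (rule nn_integral_multc) simp
  also have "(\<integral>\<^sup>+i. ennreal (L i) \<partial>measure_pmf P) = ennreal rate"
    unfolding rate_def using integrable_L L_nonneg by (intro nn_integral_eq_integral) auto
  also have "ennreal rate * ennreal (rate ^ n * D) = ennreal (rate ^ Suc n * D)"
    using rate_nonneg by (simp add: ennreal_mult'[symmetric] mult.assoc)
  finally show ?case by (simp add: D_def)
qed

lemma nn_integral_orbit_length: "(\<integral>\<^sup>+\<omega>. orbit_length \<omega> \<partial>\<Omega>) < \<infinity>"
proof -
  define D where "D = (\<integral>i. dist a (T i a) \<partial>measure_pmf P)"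
  have D: "0 \<le> D" by (simp add: D_def)
  have sm: "summable (\<lambda>n. rate ^ n * D)"
    using rate_nonneg rate_less_1 by (intro summable_mult2 summable_geometric) simp
  have "(\<integral>\<^sup>+\<omega>. orbit_length \<omega> \<partial>\<Omega>) =
      (\<Sum>n. \<integral>\<^sup>+\<omega>. ennreal (dist (orbit n \<omega>) (orbit (Suc n) \<omega>)) \<partial>\<Omega>)"
    unfolding orbit_length_def by (rule nn_integral_suminf) measurable
  also have "\<dots> \<le> (\<Sum>n. ennreal (rate ^ n * D))"
    unfolding D_def by (intro suminf_le nn_integral_orbit_step) auto
  also have "\<dots> = ennreal (\<Sum>n. rate ^ n * D)"
    using D rate_nonneg sm by (intro suminf_ennreal2) auto
  also have "\<dots> < \<infinity>" by simp
  finally show ?thesis .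
qed

lemma AE_orbit_length: "AE \<omega> in \<Omega>. orbit_length \<omega> < \<infinity>"
  using nn_integral_PInf_AE[OF measurable_orbit_length] nn_integral_orbit_length
  by (auto simp: less_top)

lemma orbit_tendsto:
  assumes "orbit_length \<omega> < \<infinity>"
  shows "(\<lambda>n. orbit n \<omega>) \<longlonglongrightarrow> orbit_limit \<omega>"
    and "ennreal (dist a (orbit_limit \<omega>)) \<le> orbit_length \<omega>"
proof -
  define d where "d n = dist (orbit n \<omega>) (orbit (Suc n) \<omega>)" for n
  have d: "0 \<le> d n" for n by (simp add: d_def)
  have sm: "summable d"
    using assms d unfolding orbit_length_def d_def[symmetric]
    by (intro summable_suminf_not_top) auto
  have "Cauchy (\<lambda>n. orbit n \<omega>)"
    using sm unfolding d_def
    by (rule Cauchy_if_summable_steps)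
  then show lim: "(\<lambda>n. orbit n \<omega>) \<longlonglongrightarrow> orbit_limit \<omega>"
    using assms by (simp add: orbit_limit_def Cauchy_convergent_iff convergent_LIMSEQ_iff)
  have bound: "dist a (orbit n \<omega>) \<le> suminf d" for n
  proof -
    have "dist a (orbit n \<omega>) \<le> (\<Sum>k<n. d k)"
    proof (induction n)
      case (Suc n)
      then show ?case using dist_triangle[of a "orbit (Suc n) \<omega>" "orbit n \<omega>"] by (simp add: d_def)
    qed simp
    also have "\<dots> \<le> suminf d" using sm d by (intro sum_le_suminf) auto
    finally show ?thesis .
  qed
  have "dist a (orbit_limit \<omega>) \<le> suminf d"
    using tendsto_dist[OF tendsto_const lim, of a] bound by (intro LIMSEQ_le_const2) auto
  then have "ennreal (dist a (orbit_limit \<omega>)) \<le> ennreal (suminf d)" by (rule ennreal_leI)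
  also have "\<dots> = orbit_length \<omega>"
    unfolding orbit_length_def d_def[symmetric] using d sm by (simp add: suminf_ennreal2)
  finally show "ennreal (dist a (orbit_limit \<omega>)) \<le> orbit_length \<omega>" .
qed

text \<open>
  Cutting off every orbit on the exceptional set gives convergence everywhere, as needed
  for a pointwise limit of Borel functions.
\<close>
lemma measurable_orbit_limit [measurable]: "orbit_limit \<in> borel_measurable \<Omega>"
proof (rule borel_measurable_LIMSEQ_metric)
  show "(\<lambda>\<omega>. if orbit_length \<omega> < \<infinity> then orbit n \<omega> else a) \<in> borel_measurable \<Omega>" for n
    by measurable
  show "(\<lambda>n. if orbit_length \<omega> < \<infinity> then orbit n \<omega> else a) \<longlonglongrightarrow> orbit_limit \<omega>" for \<omega>
    using orbit_tendsto(1)[of \<omega>] by (cases "orbit_length \<omega> < \<infinity>") (auto simp: orbit_limit_def)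
qed

text \<open>
  Since \<open>T i\<close> is continuous it commutes with the limit. Both \<open>\<omega>\<close> and \<open>i ## \<omega>\<close> must avoid
  the exceptional set; for almost every \<open>i\<close> this excludes only a null set of \<open>\<omega>\<close>.
\<close>
lemma AE_orbit_limit_Stream:
  "AE i in measure_pmf P. AE \<omega> in \<Omega>. orbit_limit (i ## \<omega>) = T i (orbit_limit \<omega>)"
proof -
  have "AE i in measure_pmf P. AE \<omega> in \<Omega>. orbit_length (i ## \<omega>) < \<infinity>"
    using AE_orbit_length by (subst (asm) prob_space.AE_stream_space[OF prob_space_measure_pmf]) auto
  then show ?thesis
  proof (rule eventually_mono)
    fix i assume "AE \<omega> in \<Omega>. orbit_length (i ## \<omega>) < \<infinity>"
    then show "AE \<omega> in \<Omega>. orbit_limit (i ## \<omega>) = T i (orbit_limit \<omega>)"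
      using AE_orbit_length
    proof eventually_elim
      case (elim \<omega>)
      have "isCont (T i) (orbit_limit \<omega>)"
        using lipschitz_on_continuous_on[OF lipschitz] by (simp add: continuous_on_eq_continuous_at)
      then have "(\<lambda>n. T i (orbit n \<omega>)) \<longlonglongrightarrow> T i (orbit_limit \<omega>)"
        using orbit_tendsto(1)[OF elim(2)] by (rule isCont_tendsto_compose)
      moreover have "(\<lambda>n. T i (orbit n \<omega>)) \<longlonglongrightarrow> orbit_limit (i ## \<omega>)"
        using LIMSEQ_Suc[OF orbit_tendsto(1)[OF elim(1)]] by (simp add: orbit_Suc_Stream)
      ultimately show ?case by (rule LIMSEQ_unique[symmetric])
    qed
  qed
qed

definition limit_law :: "'a measure" where
  "limit_law = distr \<Omega> borel orbit_limit"

lemma stationary_limit_law: "stationary limit_law"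
  unfolding stationary_def
proof
  fix A :: "'a set" assume A [measurable]: "A \<in> sets borel"
  have "emeasure limit_law A = emeasure \<Omega> (orbit_limit -` A)"
    by (simp add: limit_law_def emeasure_distr)
  also have "\<dots> = (\<integral>\<^sup>+i. emeasure \<Omega> {\<omega>. orbit_limit (i ## \<omega>) \<in> A} \<partial>measure_pmf P)"
    using measurable_sets[OF measurable_orbit_limit A]
    by (subst prob_space.emeasure_stream_space[OF prob_space_measure_pmf]) simp_all
  also have "\<dots> = (\<integral>\<^sup>+i. emeasure limit_law (T i -` A) \<partial>measure_pmf P)"
  proof (rule nn_integral_cong_AE)
    show "AE i in measure_pmf P.
        emeasure \<Omega> {\<omega>. orbit_limit (i ## \<omega>) \<in> A} = emeasure limit_law (T i -` A)"
      using AE_orbit_limit_Stream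
    proof eventually_elim
      case (elim i)
      have TA: "T i -` A \<in> sets borel" using measurable_sets[OF measurable_T A] by simp
      have m1: "{\<omega> \<in> space \<Omega>. orbit_limit (i ## \<omega>) \<in> A} \<in> sets \<Omega>" by measurable
      have m2: "{\<omega> \<in> space \<Omega>. T i (orbit_limit \<omega>) \<in> A} \<in> sets \<Omega>" by measurable
      have "emeasure \<Omega> {\<omega>. orbit_limit (i ## \<omega>) \<in> A} = emeasure \<Omega> {\<omega>. T i (orbit_limit \<omega>) \<in> A}"
        using elim m1 m2 by (intro emeasure_eq_AE) auto
      also have "\<dots> = emeasure limit_law (T i -` A)"
        using TA by (simp add: limit_law_def emeasure_distr vimage_def)
      finally show ?case .
    qed
  qed
  finally show "emeasure limit_law A = (\<integral>\<^sup>+i. emeasure limit_law (T i -` A) \<partial>measure_pmf P)" .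
qed

lemma separable_limit_law: "separable_measure limit_law"
proof -
  define C where "C = closure (range (\<lambda>l. foldr T l a))"
  have inC: "orbit_limit \<omega> \<in> C" for \<omega>
  proof (cases "orbit_length \<omega> < \<infinity>")
    case True
    then show ?thesis
      using orbit_tendsto(1)[of \<omega>] unfolding C_def closure_sequential
      by (intro exI[of _ "\<lambda>n. orbit n \<omega>"]) (simp add: orbit_def)
  next
    case False
    have "foldr T [] a \<in> C" unfolding C_def by (rule subsetD[OF closure_subset rangeI])
    then show ?thesis using False by (simp add: orbit_limit_def)
  qed
  have "C \<in> sets borel" by (simp add: C_def)
  moreover have "separable_set C" unfolding separable_set_def C_def
    by (intro exI[of _ "range (\<lambda>l. foldr T l a)"]) simp
  moreover have "emeasure limit_law (UNIV - C) = 0"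
  proof -
    have "orbit_limit -` (UNIV - C) = {}" using inC by auto
    then show ?thesis using \<open>C \<in> sets borel\<close> by (simp add: limit_law_def emeasure_distr)
  qed
  ultimately show ?thesis unfolding separable_measure_def by blast
qed

text \<open>
  Integrability of all Lipschitz functions reduces to that of the distance from \<open>a\<close>,
  which is dominated along the orbit by its length.
\<close>
lemma limit_law_in_M_space: "limit_law \<in> M_space"
proof -
  have prob: "prob_space limit_law"
    unfolding limit_law_def by (intro prob_space.prob_space_distr prob_space_\<Omega>) measurable
  then interpret prob_space limit_law .
  have sets [measurable_cong]: "sets limit_law = sets borel" by (simp add: limit_law_def)
  have dm: "dist a \<in> borel_measurable borel"
    using lipschitz_borel_measurable[OF lipschitz_dist] .
  have "(\<integral>\<^sup>+y. ennreal (dist a y) \<partial>limit_law) = (\<integral>\<^sup>+\<omega>. ennreal (dist a (orbit_limit \<omega>)) \<partial>\<Omega>)"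
    unfolding limit_law_def using dm by (intro nn_integral_distr) auto
  also have "\<dots> \<le> (\<integral>\<^sup>+\<omega>. orbit_length \<omega> \<partial>\<Omega>)"
    using AE_orbit_length by (intro nn_integral_mono_AE) (auto elim!: eventually_mono intro: orbit_tendsto(2))
  also have "\<dots> < \<infinity>" by (rule nn_integral_orbit_length)
  finally have intd: "integrable limit_law (\<lambda>y. dist a y)"
    using dm sets by (intro integrableI_bounded) (auto cong: measurable_cong_sets)
  have "integrable limit_law f" if f: "C-lipschitz_on UNIV f" for f :: "'a \<Rightarrow> real" and C
  proof (rule Bochner_Integration.integrable_bound)
    show "integrable limit_law (\<lambda>y. \<bar>f a\<bar> + C * dist a y)"
      using intd by simp
    show "f \<in> borel_measurable limit_law"
      using lipschitz_borel_measurable[OF f] sets by (simp cong: measurable_cong_sets)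
    have "\<bar>f y\<bar> \<le> \<bar>f a\<bar> + C * dist a y" for y
      using lipschitz_onD[OF f, of a y] by (simp add: dist_real_def)
    then show "AE y in limit_law. norm (f y) \<le> norm (\<bar>f a\<bar> + C * dist a y)"
      by (intro AE_I2) (simp add: order_trans[OF _ abs_ge_self])
  qed
  then show ?thesis using prob sets separable_limit_law by (auto simp: M_space_def)
qed

theorem ex1_stationary: "\<exists>!\<nu>. \<nu> \<in> M_space \<and> stationary \<nu>"
  using limit_law_in_M_space stationary_limit_law stationary_unique by blast

end

section \<open>Countable systems of contractions\<close>

lemma probability_vector_pmf:
  fixes p :: "nat \<Rightarrow> real"
  assumes "\<And>n. 0 \<le> p n" and "p sums 1"
  obtains P where "\<And>n. pmf P n = p n"
proof
  have "(\<integral>\<^sup>+n. ennreal (p n) \<partial>count_space UNIV) = 1"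
    using assms by (simp add: nn_integral_count_space_nat suminf_ennreal2 sums_iff)
  then show "pmf (embed_pmf p) n = p n" for n
    using assms by (intro pmf_embed_pmf) auto
qed

lemma nn_integral_nat_pmf:
  fixes P :: "nat pmf"
  shows "(\<integral>\<^sup>+n. f n \<partial>measure_pmf P) = (\<Sum>n. ennreal (pmf P n) * f n)"
  by (simp add: nn_integral_measure_pmf nn_integral_count_space_nat)

lemma integrable_nat_pmf:
  fixes P :: "nat pmf" and g :: "nat \<Rightarrow> real"
  assumes "\<And>n. 0 \<le> g n" and "summable (\<lambda>n. pmf P n * g n)"
  shows "integrable (measure_pmf P) g"
proof (rule integrableI_bounded)
  have "(\<integral>\<^sup>+n. ennreal (norm (g n)) \<partial>measure_pmf P) = (\<Sum>n. ennreal (pmf P n * g n))"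
    using assms(1) by (simp add: nn_integral_nat_pmf ennreal_mult)
  also have "\<dots> = ennreal (\<Sum>n. pmf P n * g n)"
    using assms by (intro suminf_ennreal2) auto
  finally show "(\<integral>\<^sup>+n. ennreal (norm (g n)) \<partial>measure_pmf P) < \<infinity>" by simp
qed simp

theorem theorem5p3:
  fixes S :: "nat \<Rightarrow> 'a::complete_space \<Rightarrow> 'a"
    and x :: "nat \<Rightarrow> 'a"
    and p :: "nat \<Rightarrow> real"
  assumes contraction: "\<And>i. i \<ge> 1 \<Longrightarrow> \<exists>L<1. L-lipschitz_on UNIV (S i)"
    and fixed_point: "\<And>i. i \<ge> 1 \<Longrightarrow> S i (x i) = x i"
    and p_nonneg: "\<And>i. i \<ge> 1 \<Longrightarrow> p i \<ge> 0"
    and p_sum: "(\<lambda>n. p (Suc n)) sums 1"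
    and p_dist: "summable (\<lambda>n. p (Suc n) * dist (x 1) (x (Suc n)))"
  shows "\<exists>!\<nu>. \<nu> \<in> M_space \<and>
    (\<forall>A\<in>sets borel. emeasure \<nu> A =
       (\<Sum>n. ennreal (p (Suc n)) * emeasure \<nu> (S (Suc n) -` A)))"
proof -
  obtain P where P: "\<And>n. pmf P n = p (Suc n)"
    using probability_vector_pmf[of "\<lambda>n. p (Suc n)"] p_nonneg p_sum by auto
  have "\<forall>n. \<exists>l<1. l-lipschitz_on UNIV (S (Suc n))"
    using contraction by simp
  then obtain L where L: "\<And>n. L n < 1" "\<And>n. (L n)-lipschitz_on UNIV (S (Suc n))"
    by metis
  have L0: "0 \<le> L n" for n using L(2) lipschitz_on_nonneg by blast
  have intL: "integrable (measure_pmf P) L"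
    using L(1) L0 by (intro measure_pmf.integrable_const_bound[where B=1]) (auto simp: less_imp_le)
  \<comment> \<open>Go from \<open>x\<^sub>1\<close> to the fixed point \<open>x\<^sub>n\<^sub>+\<^sub>1\<close>, which \<open>S\<^sub>n\<^sub>+\<^sub>1\<close> leaves in place, and back.\<close>
  have displacement: "dist (x 1) (S (Suc n) (x 1)) \<le> 2 * dist (x 1) (x (Suc n))" for n
  proof -
    have "dist (x 1) (S (Suc n) (x 1))
        \<le> dist (x 1) (x (Suc n)) + dist (S (Suc n) (x (Suc n))) (S (Suc n) (x 1))"
      using dist_triangle[of "x 1" "S (Suc n) (x 1)" "x (Suc n)"] fixed_point[of "Suc n"] by simp
    also have "dist (S (Suc n) (x (Suc n))) (S (Suc n) (x 1)) \<le> L n * dist (x (Suc n)) (x 1)"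
      using lipschitz_onD[OF L(2)] by simp
    also have "L n * dist (x (Suc n)) (x 1) \<le> 1 * dist (x (Suc n)) (x 1)"
      using L(1)[of n] by (intro mult_right_mono) auto
    finally show ?thesis by (simp add: dist_commute)
  qed
  interpret average_contraction P "\<lambda>n. S (Suc n)" L "x 1"
  proof
    show "(\<integral>n. L n \<partial>measure_pmf P) < 1"
      using intL L(1) by (intro measure_pmf.expectation_less) auto
    have "integrable (measure_pmf P) (\<lambda>n. dist (x 1) (x (Suc n)))"
      using p_dist by (intro integrable_nat_pmf) (auto simp: P)
    then have "integrable (measure_pmf P) (\<lambda>n. 2 * dist (x 1) (x (Suc n)))"
      by (rule integrable_mult_right)
    then show "integrable (measure_pmf P) (\<lambda>n. dist (x 1) (S (Suc n) (x 1)))"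
    proof (rule Bochner_Integration.integrable_bound)
      show "AE n in measure_pmf P.
          norm (dist (x 1) (S (Suc n) (x 1))) \<le> norm (2 * dist (x 1) (x (Suc n)))"
        using displacement by (intro AE_I2) (simp only: real_norm_def abs_mult abs_numeral abs_of_nonneg[OF zero_le_dist])
    qed simp
  qed (use L(2) intL in auto)
  show ?thesis
    using ex1_stationary by (simp add: stationary_def nn_integral_nat_pmf P)
qed

end
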